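(* Let $I=[x,y]$ and $J=[x',y']$ be closed intervals in $\mathbb{R}$ with $x<y$ and $x'<y'$. Let $\{f_n\}_{n=1}^{\infty}$ be a sequence of functions from $I$ to $2^{I}$ which are all countably Markov interval functions with respect to one and the same set $A\subseteq I$, and let $\{g_n\}_{n=1}^{\infty}$ be a sequence of functions from $J$ to $2^{J}$ which are all countably Markov interval functions with respect to one and the same set $B\subseteq J$. If, for each positive integer $n$, $f_n$ and $g_n$ follow the same pattern with respect to $A$ and $B$, then $\varprojlim\{I,f_n\}_{n=1}^{\infty}$ is homeomorphic to $\varprojlim\{J,g_n\}_{n=1}^{\infty}$.
   Context: For a compact metric space $X$, $2^X$ denotes the set of all nonempty closed subsets of $X$. A function $f:X\to 2^Y$ is upper semicontinuous (u.s.c.) if for each open $V\subseteq Y$ the set $\{x\in X : f(x)\subseteq V\}$ is open in $X$ (for compact metric $X,Y$ this is equivalent to the graph $\Gamma(f)=\{(x,y)\in X\times Y : y\in f(x)\}$ being closed in $X\times Y$). One-sided limits. For a closed interval $I=[x,y]$, a function $f:I\to 2^I$ and $a\in I$, define $$\mathrm{Lim}_{t\uparrow a} f(t)=\{s\in I : \text{for each }\varepsilon>0\text{ there is } z\in (a-\varepsilon,a)\cap I \text{ with } (\{z\}\times f(z))\cap B_\varepsilon((a,s))\neq\emptyset\},$$ $$\mathrm{Lim}_{t\downarrow a} f(t)=\{s\in I : \text{for each }\varepsilon>0\text{ there is } z\in (a,a+\varepsilon)\cap I \text{ with } (\{z\}\times f(z))\cap B_\varepsilon((a,s))\neq\emptyset\},$$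 where $B_\varepsilon$ denotes the open ball in $I\times I$. In particular $\mathrm{Lim}_{t\uparrow x}f(t)=\emptyset=\mathrm{Lim}_{t\downarrow y}f(t)$. Countably Markov interval function. Let $x<y$ be reals and let $A$ be a countable (finite or countably infinite) subset of $I=[x,y]$ containing $x$ and $y$ and such that the derived set $A'$ of $A$ (the set of its accumulation points) is a finite subset of $A$. A u.s.c. function $f:I\to 2^I$ is a countably Markov interval function with respect to $A$ if: (1) for each $a\in A$ there exist $u,v\in A$ with $u\le v$ and $f(a)=[u,v]$ ($u=v$ is allowed); (2) the restriction of $f$ to every interval (component) of $I\setminus A$ is an injective single-valued function (i.e. each $f(t)$ is a singleton there, and distinct points of the component have distinct images); (3) for each $a\in A\setminus A'$, $\mathrm{Lim}_{t\downarrow a}f(t)$ and $\mathrm{Lim}_{t\uparrow a}f(t)$ are subsets of $A$; (4) if $a\in A'$ and $a\ne x$, then $\min(\mathrm{Lim}_{t\uparrow a}f(t)),\max(\mathrm{Lim}_{t\uparrow a}f(t))\in A$; if $a\in A'$ and $a\neq y$, then $\min(\mathrm{Lim}_{t\downarrow a}f(t)),\max(\mathrm{Lim}_{t\downarrow a}f(t))\in A$. Same pattern. Let $f:I\to 2^I$ be a countably Markov interval function with respect to $A$ and $g:J\to 2^J$ a countably Markov interval function with respect to $B$. Then $f$ and $g$ follow the same pattern with respect to $A$ and $B$ if there exists an increasing bijective function $\tau:A\to B$ such that for each $a\in A$ and for all $u,v\in A$ ($u=v$ is allowed): (1) $f(a)=[u,v]$ if and only if $g(\tau(a))=[\tau(u),\tau(v)]$;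 (2) $\mathrm{Lim}_{t\uparrow a}f(t)=[u,v]$ if and only if $\mathrm{Lim}_{t\uparrow\tau(a)}g(t)=[\tau(u),\tau(v)]$; (3) $\mathrm{Lim}_{t\downarrow a}f(t)=[u,v]$ if and only if $\mathrm{Lim}_{t\downarrow\tau(a)}g(t)=[\tau(u),\tau(v)]$. Inverse limit. For u.s.c. functions $f_n:I\to 2^I$, $n\ge 1$, $\varprojlim\{I,f_n\}_{n=1}^\infty$ is the subspace of $\prod_{n=1}^\infty I$ (product topology) consisting of all $(x_1,x_2,\ldots)$ with $x_n\in f_n(x_{n+1})$ for each $n\geq 1$.
   Formalization: The formal theorem requires one increasing bijection τ: A→B witnessing the same pattern for all n at once; if τ may vary with n, the claim is false (one inverse limit can contain a Knaster continuum while the other is an arc). *)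

theory Defs
  imports "HOL-Analysis.Analysis"
begin

text \<open>A map from \<open>X\<close> to \<open>2\<^sup>Y\<close> is a set-valued function whose values at the
  points of \<open>X\<close> are nonempty and closed in \<open>Y\<close>; values outside \<open>X\<close> are irrelevant.\<close>

definition set_valued_on ::
    "'a set \<Rightarrow> 'b::topological_space set \<Rightarrow> ('a \<Rightarrow> 'b set) \<Rightarrow> bool" where
  "set_valued_on X Y f \<longleftrightarrow>
     (\<forall>t\<in>X. f t \<noteq> {} \<and> closedin (top_of_set Y) (f t))"

definition usc_on ::
    "'a::topological_space set \<Rightarrow> 'b::topological_space set \<Rightarrow> ('a \<Rightarrow> 'b set) \<Rightarrow> bool" where
  "usc_on X Y f \<longleftrightarrow>
     (\<forall>V. openin (top_of_set Y) V \<longrightarrow> openin (top_of_set X) {t \<in> X. f t \<subseteq> V})"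

definition Lim_up :: "real set \<Rightarrow> (real \<Rightarrow> real set) \<Rightarrow> real \<Rightarrow> real set" where
  "Lim_up I f a = {s \<in> I. \<forall>e>0. \<exists>z \<in> {a - e<..<a} \<inter> I.
      ({z} \<times> f z) \<inter> (ball (a, s) e \<inter> I \<times> I) \<noteq> {}}"

definition Lim_down :: "real set \<Rightarrow> (real \<Rightarrow> real set) \<Rightarrow> real \<Rightarrow> real set" where
  "Lim_down I f a = {s \<in> I. \<forall>e>0. \<exists>z \<in> {a<..<a + e} \<inter> I.
      ({z} \<times> f z) \<inter> (ball (a, s) e \<inter> I \<times> I) \<noteq> {}}"

definition derived_set :: "real set \<Rightarrow> real set" where
  "derived_set A = {a. a islimpt A}"

text \<open>The minimum (maximum) of \<open>S\<close> exists and lies in \<open>A\<close>; the library's \<open>Min\<close> and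
  \<open>Max\<close> are meaningful for finite sets only.\<close>

definition min_in :: "real set \<Rightarrow> real set \<Rightarrow> bool" where
  "min_in S A \<longleftrightarrow> (\<exists>m\<in>A. m \<in> S \<and> (\<forall>s\<in>S. m \<le> s))"

definition max_in :: "real set \<Rightarrow> real set \<Rightarrow> bool" where
  "max_in S A \<longleftrightarrow> (\<exists>m\<in>A. m \<in> S \<and> (\<forall>s\<in>S. s \<le> m))"

definition countably_Markov ::
    "real \<Rightarrow> real \<Rightarrow> real set \<Rightarrow> (real \<Rightarrow> real set) \<Rightarrow> bool" where
  "countably_Markov x y A f \<longleftrightarrow>
     x < y \<and> countable A \<and> A \<subseteq> {x..y} \<and> x \<in> A \<and> y \<in> A \<and>
     finite (derived_set A) \<and> derived_set A \<subseteq> A \<and>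
     set_valued_on {x..y} {x..y} f \<and> usc_on {x..y} {x..y} f \<and>
     (\<forall>a\<in>A. \<exists>u\<in>A. \<exists>v\<in>A. u \<le> v \<and> f a = {u..v}) \<and>
     (\<forall>C \<in> components ({x..y} - A). (\<forall>t\<in>C. is_singleton (f t)) \<and> inj_on f C) \<and>
     (\<forall>a \<in> A - derived_set A. Lim_down {x..y} f a \<subseteq> A \<and> Lim_up {x..y} f a \<subseteq> A) \<and>
     (\<forall>a \<in> derived_set A.
        (a \<noteq> x \<longrightarrow> min_in (Lim_up {x..y} f a) A \<and> max_in (Lim_up {x..y} f a) A) \<and>
        (a \<noteq> y \<longrightarrow> min_in (Lim_down {x..y} f a) A \<and> max_in (Lim_down {x..y} f a) A))"

text \<open>\<open>f\<close> and \<open>g\<close> follow the same pattern with respect to \<open>A\<close> and \<open>B\<close>, as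
  witnessed by the increasing bijection \<open>\<tau>\<close>. The guard \<open>u \<le> v\<close> is the convention
  that \<open>[u,v]\<close> denotes an interval with ordered endpoints.\<close>

definition same_pattern_via ::
    "(real \<Rightarrow> real) \<Rightarrow> real set \<Rightarrow> real set \<Rightarrow> (real \<Rightarrow> real set) \<Rightarrow>
     real set \<Rightarrow> real set \<Rightarrow> (real \<Rightarrow> real set) \<Rightarrow> bool" where
  "same_pattern_via \<tau> I A f J B g \<longleftrightarrow>
     bij_betw \<tau> A B \<and> strict_mono_on A \<tau> \<and>
     (\<forall>a\<in>A. \<forall>u\<in>A. \<forall>v\<in>A. u \<le> v \<longrightarrow>
        (f a = {u..v} \<longleftrightarrow> g (\<tau> a) = {\<tau> u..\<tau> v}) \<and>
        (Lim_up I f a = {u..v} \<longleftrightarrow> Lim_up J g (\<tau> a) = {\<tau> u..\<tau> v}) \<and>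
        (Lim_down I f a = {u..v} \<longleftrightarrow> Lim_down J g (\<tau> a) = {\<tau> u..\<tau> v}))"

text \<open>For a single pair \<open>f\<close>, \<open>g\<close> the relation is \<open>\<exists>\<tau>. same_pattern_via \<tau> I A f J B g\<close>.
  For sequences \<open>f n\<close>, \<open>g n\<close> that follow the same pattern with respect to the same \<open>A\<close>
  and \<open>B\<close>, the bijection \<open>\<tau>\<close> is one and the same for all \<open>n\<close>.
  When the increasing bijection from \<open>A\<close> to \<open>B\<close> is unique (in particular for finite \<open>A\<close>)
  this is the same as a separate \<open>\<tau>\<close> for each \<open>n\<close>. In general it is not, and with
  varying \<open>\<tau>\<close> the inverse limits need not be homeomorphic:

  Let \<open>A = B = {0, 1} \<union> {p i | i integer}\<close> in \<open>[0,1]\<close>, with \<open>p\<close> increasing, tending to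
  \<open>0\<close> and \<open>1\<close> at the two ends. Let \<open>f\<close> be the single-valued map fixing \<open>0\<close>, \<open>1\<close> and all
  \<open>p i\<close> with \<open>i \<le> 0\<close> or \<open>i \<ge> 4\<close>, sending \<open>p 1\<close>, \<open>p 2\<close>, \<open>p 3\<close> to \<open>p 2\<close>, \<open>p 0\<close>, \<open>p 2\<close>, and
  affine between neighbouring points of \<open>A\<close>. Let \<open>s\<close> fix \<open>0\<close> and \<open>1\<close>, send \<open>p i\<close> to
  \<open>p (i + 10)\<close>, and be affine in between. Put \<open>f n = f\<close> and let \<open>g n\<close> be the conjugate
  of \<open>f\<close> by the \<open>n\<close>-th iterate of \<open>s\<close>, whose restriction to \<open>A\<close> witnesses the same pattern.
  The first inverse limit contains the Knaster continuum (over \<open>[p 0, p 2]\<close>), whereas the second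
  is homeomorphic to the inverse limit of the constant sequence \<open>f \<circ> s\<close>, which is an arc.\<close>

text \<open>Sequences are indexed from \<open>0\<close>. The topology on \<open>nat \<Rightarrow> real\<close> is the product topology.\<close>

definition inverse_limit ::
    "real set \<Rightarrow> (nat \<Rightarrow> real \<Rightarrow> real set) \<Rightarrow> (nat \<Rightarrow> real) set" where
  "inverse_limit I f = {p. (\<forall>n. p n \<in> I) \<and> (\<forall>n. p n \<in> f n (p (Suc n)))}"

end

theory Submission
  imports Defs
begin

text \<open>
  The inverse limits are matched coordinate by coordinate. The single increasing bijection
  \<open>\<tau> : A \<rightarrow> B\<close> shared by all pairs \<open>f\<^sub>n, g\<^sub>n\<close> is extended to increasing homeomorphisms
  \<open>h\<^sub>n : I \<rightarrow> J\<close> satisfying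

    \<open>g\<^sub>n (h\<^sub>n\<^sub>+\<^sub>1 t) = h\<^sub>n ` f\<^sub>n t\<close> for all \<open>t \<in> I\<close>;

  then \<open>p \<mapsto> (\<lambda>n. h\<^sub>n (p n))\<close> carries one inverse limit onto the other.

  The start \<open>h\<^sub>0\<close> is piecewise affine, and \<open>h\<^sub>n\<^sub>+\<^sub>1\<close> is obtained by lifting \<open>h\<^sub>n\<close>
  (\<open>lift_extension\<close>). On \<open>A\<close> the lift has to be \<open>\<tau>\<close>, and there the equation is the part of the
  pattern that concerns the values at points of \<open>A\<close>. On a gap \<open>(a,b)\<close> of \<open>A\<close> the function
  \<open>f\<^sub>n\<close> is single-valued, continuous and injective, hence a monotone homeomorphism onto an open
  interval whose endpoints are the one-sided limits of \<open>f\<^sub>n\<close> at \<open>a\<close> and \<open>b\<close>; these lie in \<open>A\<close>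
  (\<open>Markov_on_gap\<close>). The part of the pattern that concerns one-sided limits says that \<open>g\<^sub>n\<close>
  maps the gap \<open>(\<tau> a, \<tau> b)\<close> of \<open>B\<close> onto the \<open>h\<^sub>n\<close>-image of that interval, with the same
  orientation, so on the gap the lift is \<open>(g\<^sub>n)\<^sup>-\<^sup>1 \<circ> h\<^sub>n \<circ> f\<^sub>n\<close>. Increasing bijections of
  the gaps always glue with \<open>\<tau>\<close> to an increasing bijection of \<open>I\<close> onto \<open>J\<close>
  (\<open>glue_over_gaps\<close>), and such a bijection of intervals is automatically a homeomorphism.
\<close>

section \<open>Increasing bijections of intervals\<close>

text \<open>
  Every bound \<open>l\<close> close to \<open>h t\<close> is itself a value \<open>h u\<close> because the image has no holes, so the
  inequality between \<open>h s\<close> and \<open>l\<close> is the inequality between \<open>s\<close> and \<open>u\<close>.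
\<close>

lemma increasing_surjection_continuous:
  fixes h :: "real \<Rightarrow> real"
  assumes mono: "strict_mono_on I h" and img: "h ` I = {x'..y'}"
  shows "continuous_on I h"
  unfolding continuous_on_def
proof
  fix t assume t: "t \<in> I"
  then have ht: "h t \<in> {x'..y'}" using img by blast
  show "(h \<longlongrightarrow> h t) (at t within I)"
  proof (rule order_tendstoI)
    fix l assume l: "l < h t"
    show "\<forall>\<^sub>F s in at t within I. l < h s"
    proof (cases "l < x'")
      case True
      moreover have "h s \<in> {x'..y'}" if "s \<in> I" for s using img that by blast
      ultimately have "l < h s" if "s \<in> I" for s using that by force
      then show ?thesis by (simp add: eventually_at_filter)
    next
      case False
      then have "l \<in> h ` I" using l ht img by auto
      then obtain u where u: "u \<in> I" "l = h u" by blast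
      then have "u < t" using l t strict_mono_on_less[OF mono] by blast
      then have "\<forall>\<^sub>F s in nhds t. u < s" using order_tendstoD(1)[OF filterlim_ident] by blast
      then show ?thesis unfolding eventually_at_filter
        by eventually_elim (use u mono in \<open>auto dest: strict_mono_onD\<close>)
    qed
  next
    fix l assume l: "h t < l"
    show "\<forall>\<^sub>F s in at t within I. h s < l"
    proof (cases "l > y'")
      case True
      moreover have "h s \<in> {x'..y'}" if "s \<in> I" for s using img that by blast
      ultimately have "h s < l" if "s \<in> I" for s using that by force
      then show ?thesis by (simp add: eventually_at_filter)
    next
      case False
      then have "l \<in> h ` I" using l ht img by auto
      then obtain u where u: "u \<in> I" "l = h u" by blast
      then have "t < u" using l t strict_mono_on_less[OF mono] by blast
      then have "\<forall>\<^sub>F s in nhds t. s < u" using order_tendstoD(2)[OF filterlim_ident] by blast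
      then show ?thesis unfolding eventually_at_filter
        by eventually_elim (use u mono in \<open>auto dest: strict_mono_onD\<close>)
    qed
  qed
qed

lemma inv_into_increasing:
  fixes h :: "'a::linorder \<Rightarrow> 'b::linorder"
  assumes "strict_mono_on I h"
  shows "strict_mono_on (h ` I) (inv_into I h)"
proof (rule strict_mono_onI)
  fix r s assume "r \<in> h ` I" "s \<in> h ` I" "r < s"
  moreover from this have "inv_into I h r \<in> I" "inv_into I h s \<in> I"
    by (simp_all add: inv_into_into)
  ultimately show "inv_into I h r < inv_into I h s"
    using strict_mono_on_less[OF assms] by (metis f_inv_into_f)
qed

lemma increasing_bijection_image_Icc:
  fixes h :: "real \<Rightarrow> real"
  assumes mono: "strict_mono_on I h" and J: "h ` I = {x'..y'}" and u: "u \<in> I" and v: "v \<in> I"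
    and sub: "{u..v} \<subseteq> I"
  shows "h ` {u..v} = {h u..h v}"
proof
  show "h ` {u..v} \<subseteq> {h u..h v}"
  proof
    fix s assume "s \<in> h ` {u..v}"
    then obtain t where t: "t \<in> {u..v}" "s = h t" by blast
    then have "t \<in> I" using sub by blast
    then show "s \<in> {h u..h v}"
      using t strict_mono_on_less_eq[OF mono u] strict_mono_on_less_eq[OF mono _ v] by simp
  qed
  show "{h u..h v} \<subseteq> h ` {u..v}"
  proof
    fix s assume s: "s \<in> {h u..h v}"
    have "h u \<in> {x'..y'}" "h v \<in> {x'..y'}" using u v J by blast+
    then have "s \<in> h ` I" using s J by auto
    then obtain t where t: "t \<in> I" "s = h t" by blast
    have "u \<le> t" "t \<le> v"
      using s t(2) strict_mono_on_less_eq[OF mono u t(1)] strict_mono_on_less_eq[OF mono t(1) v]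
      by auto
    then show "s \<in> h ` {u..v}" using t by auto
  qed
qed

lemma increasing_bijection_image_Ioo:
  fixes h :: "real \<Rightarrow> real"
  assumes mono: "strict_mono_on I h" and J: "h ` I = {x'..y'}" and u: "u \<in> I" and v: "v \<in> I"
    and sub: "{u..v} \<subseteq> I"
  shows "h ` {u<..<v} = {h u<..<h v}"
proof (cases "u \<le> v")
  case True
  have inj: "inj_on h I" using mono by (rule strict_mono_on_imp_inj_on)
  have "{u<..<v} = {u..v} - {u, v}" by auto
  then have "h ` {u<..<v} = h ` {u..v} - h ` {u, v}"
    using inj_on_image_set_diff[OF inj, of "{u..v}" "{u, v}"] sub u v by auto
  also have "\<dots> = {h u..h v} - {h u, h v}" using increasing_bijection_image_Icc[OF assms] by simp
  also have "\<dots> = {h u<..<h v}" by auto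
  finally show ?thesis .
next
  case False
  then have "h v < h u" using strict_mono_onD[OF mono v u] by simp
  then show ?thesis using False by auto
qed

section \<open>Gaps and gluing\<close>

definition gap :: "real set \<Rightarrow> real \<Rightarrow> real \<Rightarrow> bool" where
  "gap A a b \<longleftrightarrow> a \<in> A \<and> b \<in> A \<and> a < b \<and> A \<inter> {a<..<b} = {}"

lemma in_gap:
  assumes "closed A" "A \<subseteq> {x..y}" "x \<in> A" "y \<in> A" "t \<in> {x..y}" "t \<notin> A"
  obtains a b where "gap A a b" "a < t" "t < b"
proof -
  let ?L = "A \<inter> {x..t}" and ?R = "A \<inter> {t..y}"
  have ne: "?L \<noteq> {}" "?R \<noteq> {}" and cpt: "compact ?L" "compact ?R"
    using assms by (auto simp: closed_Int_compact)
  obtain a where a: "a \<in> ?L" "\<forall>s\<in>?L. s \<le> a" using compact_attains_sup[OF cpt(1) ne(1)] by blast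
  obtain b where b: "b \<in> ?R" "\<forall>s\<in>?R. b \<le> s" using compact_attains_inf[OF cpt(2) ne(2)] by blast
  have "a \<noteq> t" "b \<noteq> t" using a b assms by auto
  then have "a < t" "t < b" using a b by auto
  moreover have "e \<le> a \<or> b \<le> e" if "e \<in> A" for e
    using that a(2) b(2) assms(2) by (cases "e \<le> t") auto
  then have "gap A a b"
    unfolding gap_def using a(1) b(1) \<open>a < t\<close> \<open>t < b\<close> by force
  ultimately show thesis using that by blast
qed

lemma gap_unique:
  assumes "gap A a b" "gap A c d" "t \<in> {a<..<b}" "t \<in> {c<..<d}"
  shows "c = a" "d = b"
proof -
  have "c \<notin> {a<..<b}" "d \<notin> {a<..<b}" "a \<notin> {c<..<d}" "b \<notin> {c<..<d}"
    using assms unfolding gap_def by blast+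
  then show "c = a" "d = b" using assms(3,4) by auto
qed

lemma gap_transfer:
  assumes \<tau>: "bij_betw \<tau> A B" "strict_mono_on A \<tau>" and "a \<in> A" "b \<in> A"
  shows "gap B (\<tau> a) (\<tau> b) \<longleftrightarrow> gap A a b"
proof -
  have less: "\<tau> u < \<tau> v \<longleftrightarrow> u < v" if "u \<in> A" "v \<in> A" for u v
    using that \<tau>(2) by (simp add: strict_mono_on_less)
  have "B = \<tau> ` A" using \<tau>(1) by (simp add: bij_betw_def)
  moreover have "\<tau> ` A \<inter> {\<tau> a<..<\<tau> b} = \<tau> ` (A \<inter> {a<..<b})" using less assms(3,4) by force
  ultimately show ?thesis unfolding gap_def using less assms(3,4) by simp
qed

text \<open>
  Two points of \<open>I\<close> in different gaps are separated by a point \<open>e \<in> A\<close>, and so \<open>\<tau> e\<close> separates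
  their images; this is why monotonicity on each gap and on \<open>A\<close> is enough. Surjectivity holds
  because \<open>\<tau>\<close> induces a bijection between the gaps of \<open>A\<close> and those of \<open>B\<close>. The relation \<open>P\<close>
  carries along whatever else the local bijections satisfy.
\<close>

lemma glue_over_gaps:
  fixes \<tau> :: "real \<Rightarrow> real"
  assumes A: "closed A" "A \<subseteq> {x..y}" "x \<in> A" "y \<in> A"
    and B: "closed B" "B \<subseteq> {x'..y'}" "x' \<in> B" "y' \<in> B"
    and \<tau>: "bij_betw \<tau> A B" "strict_mono_on A \<tau>"
    and loc: "\<And>a b. gap A a b \<Longrightarrow> \<exists>k. strict_mono_on {a<..<b} k \<and>
                k ` {a<..<b} = {\<tau> a<..<\<tau> b} \<and> (\<forall>t\<in>{a<..<b}. P t (k t))"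
  obtains h where "strict_mono_on {x..y} h" "h ` {x..y} = {x'..y'}"
    "\<And>a. a \<in> A \<Longrightarrow> h a = \<tau> a" "\<And>t. t \<in> {x..y} - A \<Longrightarrow> P t (h t)"
proof -
  obtain K where K: "\<And>a b. gap A a b \<Longrightarrow> strict_mono_on {a<..<b} (K a b) \<and>
      K a b ` {a<..<b} = {\<tau> a<..<\<tau> b} \<and> (\<forall>t\<in>{a<..<b}. P t (K a b t))"
    using loc by metis
  have "\<exists>a b. gap A a b \<and> t \<in> {a<..<b}" if "t \<in> {x..y} - A" for t
    using in_gap[OF A, of t] that by (metis DiffD1 DiffD2 greaterThanLessThan_iff)
  then obtain l r where lr: "\<And>t. t \<in> {x..y} - A \<Longrightarrow> gap A (l t) (r t) \<and> t \<in> {l t<..<r t}"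
    by metis
  define h where "h t = (if t \<in> A then \<tau> t else K (l t) (r t) t)" for t
  have hA: "h a = \<tau> a" if "a \<in> A" for a using that by (simp add: h_def)
  have hgap: "h t = K a b t" if "gap A a b" "t \<in> {a<..<b}" for a b t
  proof -
    have "t \<notin> A" "t \<in> {x..y}" using that A(2) unfolding gap_def by force+
    moreover from this have "l t = a" "r t = b"
      using gap_unique[OF that(1) _ that(2)] lr[of t] by blast+
    ultimately show ?thesis by (simp add: h_def)
  qed
  have hin: "\<tau> a < h t" "h t < \<tau> b" if "gap A a b" "t \<in> {a<..<b}" for a b t
    using K[OF that(1)] that(2) hgap[OF that] by (metis greaterThanLessThan_iff imageI)+
  have \<tau>le: "\<tau> u \<le> \<tau> v" if "u \<in> A" "v \<in> A" "u \<le> v" for u v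
    using strict_mono_on_leD[OF \<tau>(2)] that by blast
  have right: "h t \<le> \<tau> e" "t \<noteq> e \<Longrightarrow> h t < \<tau> e" if "t \<in> {x..y}" "e \<in> A" "t \<le> e" for t e
  proof -
    show less: "h t < \<tau> e" if "t \<noteq> e"
    proof (cases "t \<in> A")
      case True
      then show ?thesis using \<tau>(2) \<open>t \<le> e\<close> that \<open>e \<in> A\<close> by (simp add: hA strict_mono_onD)
    next
      case False
      then have g: "gap A (l t) (r t)" "t \<in> {l t<..<r t}" using lr \<open>t \<in> {x..y}\<close> by auto
      then have "r t \<le> e" using \<open>e \<in> A\<close> \<open>t \<le> e\<close> unfolding gap_def by force
      then show ?thesis using hin[OF g] \<tau>le[of "r t" e] g(1) \<open>e \<in> A\<close> unfolding gap_def by force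
    qed
    show "h t \<le> \<tau> e" using less hA[OF \<open>e \<in> A\<close>] by fastforce
  qed
  have left: "\<tau> e \<le> h t" "t \<noteq> e \<Longrightarrow> \<tau> e < h t" if "t \<in> {x..y}" "e \<in> A" "e \<le> t" for t e
  proof -
    show less: "\<tau> e < h t" if "t \<noteq> e"
    proof (cases "t \<in> A")
      case True
      then show ?thesis using \<tau>(2) \<open>e \<le> t\<close> that \<open>e \<in> A\<close> by (simp add: hA strict_mono_onD)
    next
      case False
      then have g: "gap A (l t) (r t)" "t \<in> {l t<..<r t}" using lr \<open>t \<in> {x..y}\<close> by auto
      then have "e \<le> l t" using \<open>e \<in> A\<close> \<open>e \<le> t\<close> unfolding gap_def by force
      then show ?thesis using hin[OF g] \<tau>le[of e "l t"] g(1) \<open>e \<in> A\<close> unfolding gap_def by force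
    qed
    show "\<tau> e \<le> h t" using less hA[OF \<open>e \<in> A\<close>] by fastforce
  qed
  have mono: "strict_mono_on {x..y} h"
  proof (rule strict_mono_onI)
    fix s t assume st: "s \<in> {x..y}" "t \<in> {x..y}" "s < t"
    show "h s < h t"
    proof (cases "\<exists>e\<in>A. s \<le> e \<and> e \<le> t")
      case True
      then obtain e where e: "e \<in> A" "s \<le> e" "e \<le> t" by blast
      then have "s \<noteq> e \<or> t \<noteq> e" using st by auto
      then show ?thesis using right[of s e] left[of t e] e st by force
    next
      case False
      then have g: "gap A (l s) (r s)" "s \<in> {l s<..<r s}" using lr[of s] st by force+
      then have "r s \<in> A" by (simp add: gap_def)
      then have "t \<in> {l s<..<r s}" using False st(3) g(2) by force
      then show ?thesis using K[OF g(1)] g st(3) by (metis hgap strict_mono_onD)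
    qed
  qed
  have \<tau>A: "\<tau> ` A = B" using \<tau>(1) by (simp add: bij_betw_def)
  have ends: "\<tau> x = x'" "\<tau> y = y'"
  proof -
    obtain u v where uv: "u \<in> A" "x' = \<tau> u" "v \<in> A" "y' = \<tau> v" using \<tau>A B by blast
    have "\<tau> x \<in> B" "\<tau> y \<in> B" using \<tau>A A by blast+
    then have "x' \<le> \<tau> x" "\<tau> y \<le> y'" using B(2) by auto
    moreover have "\<tau> x \<le> x'" "y' \<le> \<tau> y" using uv A \<tau>le by auto
    ultimately show "\<tau> x = x'" "\<tau> y = y'" by auto
  qed
  have img: "h ` {x..y} = {x'..y'}"
  proof
    show "h ` {x..y} \<subseteq> {x'..y'}"
      using left(1)[of _ x] right(1)[of _ y] A ends by auto
    show "{x'..y'} \<subseteq> h ` {x..y}"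
    proof
      fix s assume s: "s \<in> {x'..y'}"
      show "s \<in> h ` {x..y}"
      proof (cases "s \<in> B")
        case True
        then obtain a where "a \<in> A" "s = \<tau> a" using \<tau>A by blast
        then show ?thesis using hA A(2) by (metis imageI subsetD)
      next
        case False
        from in_gap[OF B s False] obtain c d where cd: "gap B c d" "c < s" "s < d" .
        then obtain a b where ab: "a \<in> A" "c = \<tau> a" "b \<in> A" "d = \<tau> b"
          using \<tau>A unfolding gap_def by blast
        then have g: "gap A a b" using gap_transfer[OF \<tau> ab(1,3)] cd by simp
        then obtain t where t: "t \<in> {a<..<b}" "s = K a b t"
          using K[OF g] cd ab by (metis greaterThanLessThan_iff imageE)
        then have "s = h t" using hgap[OF g] by simp
        moreover have "t \<in> {x..y}" using t(1) ab(1,3) A(2) by force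
        ultimately show ?thesis by blast
      qed
    qed
  qed
  have "P t (h t)" if "t \<in> {x..y} - A" for t
    using lr[OF that] K hgap by metis
  then show thesis using that mono img hA by blast
qed

section \<open>Countably Markov interval functions on a gap\<close>

text \<open>
  The endpoints of the image are its infimum and supremum. They are not attained since
  \<open>\<phi>\<close> is strictly increasing on an open interval, and by monotonicity they are also the one-sided
  limits.
\<close>

lemma increasing_image_Ioo:
  fixes \<phi> :: "real \<Rightarrow> real"
  assumes ab: "a < b" and cont: "continuous_on {a<..<b} \<phi>"
    and mono: "strict_mono_on {a<..<b} \<phi>" and bd: "\<phi> ` {a<..<b} \<subseteq> {x..y}"
  obtains c d where "c < d" "c \<in> {x..y}" "d \<in> {x..y}" "\<phi> ` {a<..<b} = {c<..<d}"
    "(\<phi> \<longlongrightarrow> c) (at_right a)" "(\<phi> \<longlongrightarrow> d) (at_left b)"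
proof -
  let ?S = "\<phi> ` {a<..<b}"
  define c d where "c = Inf ?S" and "d = Sup ?S"
  have ne: "?S \<noteq> {}" using ab by simp
  have bdd: "bdd_below ?S" "bdd_above ?S"
    using bd by (meson bdd_below_Icc bdd_below_mono, meson bdd_above_Icc bdd_above_mono)
  have lower: "\<exists>t\<in>{a<..<b}. \<phi> t < s" if "c < s" for s
    using that ne bdd(1) by (auto simp: c_def cInf_less_iff)
  have upper: "\<exists>t\<in>{a<..<b}. s < \<phi> t" if "s < d" for s
    using that ne bdd(2) by (auto simp: d_def less_cSup_iff)
  have strict: "c < \<phi> t" "\<phi> t < d" if t: "t \<in> {a<..<b}" for t
  proof -
    obtain r s where "a < r" "r < t" "t < s" "s < b" using dense t by (meson greaterThanLessThan_iff)
    then have "\<phi> r < \<phi> t" "\<phi> t < \<phi> s" "r \<in> {a<..<b}" "s \<in> {a<..<b}"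
      using mono t by (auto simp: strict_mono_on_def)
    moreover from this have "c \<le> \<phi> r" "\<phi> s \<le> d"
      unfolding c_def d_def using bdd by (auto intro!: cInf_lower cSup_upper)
    ultimately show "c < \<phi> t" "\<phi> t < d" by auto
  qed
  have img: "?S = {c<..<d}"
  proof
    show "?S \<subseteq> {c<..<d}" using strict by auto
    show "{c<..<d} \<subseteq> ?S"
    proof
      fix s assume s: "s \<in> {c<..<d}"
      obtain t u where tu: "t \<in> {a<..<b}" "\<phi> t < s" "u \<in> {a<..<b}" "s < \<phi> u"
        using lower upper s by (meson greaterThanLessThan_iff)
      have "connected ?S" using cont connected_Ioo by (rule connected_continuous_image)
      then show "s \<in> ?S" using tu unfolding connected_iff_interval by (meson imageI less_imp_le)
    qed
  qed
  have "c < d" using img ne by auto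
  moreover have "c \<in> {x..y}" "d \<in> {x..y}"
  proof -
    have "x \<le> c" "d \<le> y" unfolding c_def d_def using ne bd
      by (auto intro!: cInf_greatest cSup_least)
    then show "c \<in> {x..y}" "d \<in> {x..y}" using \<open>c < d\<close> by auto
  qed
  moreover have "(\<phi> \<longlongrightarrow> c) (at_right a)"
  proof (rule order_tendstoI)
    show "\<forall>\<^sub>F t in at_right a. l < \<phi> t" if "l < c" for l
      using eventually_at_right_less[of a] eventually_at_right_real[OF ab]
      by eventually_elim (use that strict in force)
    show "\<forall>\<^sub>F t in at_right a. \<phi> t < l" if "c < l" for l
    proof -
      obtain u where u: "u \<in> {a<..<b}" "\<phi> u < l" using lower \<open>c < l\<close> by blast
      then have "\<forall>\<^sub>F t in at_right a. t \<in> {a<..<u}" using eventually_at_right_real by auto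
      moreover have "\<phi> t < l" if "t \<in> {a<..<u}" for t
        using that u strict_mono_onD[OF mono, of t u] by auto
      ultimately show ?thesis by (rule eventually_mono)
    qed
  qed
  moreover have "(\<phi> \<longlongrightarrow> d) (at_left b)"
  proof (rule order_tendstoI)
    show "\<forall>\<^sub>F t in at_left b. \<phi> t < l" if "d < l" for l
      using eventually_at_left_real[OF ab]
      by eventually_elim (use that strict in force)
    show "\<forall>\<^sub>F t in at_left b. l < \<phi> t" if "l < d" for l
    proof -
      obtain u where u: "u \<in> {a<..<b}" "l < \<phi> u" using upper \<open>l < d\<close> by blast
      then have "\<forall>\<^sub>F t in at_left b. t \<in> {u<..<b}" using eventually_at_left_real by auto
      moreover have "l < \<phi> t" if "t \<in> {u<..<b}" for t
        using that u strict_mono_onD[OF mono, of u t] by auto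
      ultimately show ?thesis by (rule eventually_mono)
    qed
  qed
  ultimately show thesis using that img by blast
qed

lemma graph_point_near_iff:
  "({z} \<times> {w}) \<inter> (ball (a, s) e \<inter> I \<times> I) \<noteq> {} \<longleftrightarrow> z \<in> I \<and> w \<in> I \<and> dist (a, s) (z, w) < e"
  by auto

text \<open>
  Where \<open>f\<close> is single-valued next to \<open>a\<close>, the set-valued limit consists of the cluster points
  of the function there, so convergence makes it a singleton. To cover both sides at once,
  the one-sided neighbourhoods of radius \<open>e\<close> are a parameter \<open>S e\<close>, and the assumptions make them
  a basis of the filter \<open>F\<close>.
\<close>

lemma one_sided_limit_singleton:
  fixes \<phi> :: "real \<Rightarrow> real"
  assumes lim: "(\<phi> \<longlongrightarrow> c) F" and "F \<noteq> bot" and "F \<le> nhds a" and c: "c \<in> I"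
    and S: "\<And>e. e > 0 \<Longrightarrow> \<forall>\<^sub>F t in F. t \<in> S e"
    and near: "\<And>P. \<forall>\<^sub>F t in F. P t \<Longrightarrow> \<exists>e>0. \<forall>t\<in>S e. P t"
    and Smono: "\<And>d e. d \<le> e \<Longrightarrow> S d \<subseteq> S e"
    and single: "\<forall>\<^sub>F t in F. t \<in> I \<and> \<phi> t \<in> I \<and> f t = {\<phi> t}"
  shows "{s \<in> I. \<forall>e>0. \<exists>z \<in> S e \<inter> I. ({z} \<times> f z) \<inter> (ball (a, s) e \<inter> I \<times> I) \<noteq> {}} = {c}"
    (is "?L = _")
proof
  show "{c} \<subseteq> ?L"
  proof -
    have "\<exists>z \<in> S e \<inter> I. ({z} \<times> f z) \<inter> (ball (a, c) e \<inter> I \<times> I) \<noteq> {}" if "e > 0" for e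
    proof -
      have "((\<lambda>t. t) \<longlongrightarrow> a) F" using \<open>F \<le> nhds a\<close> by (simp add: filterlim_def)
      from tendsto_Pair[OF this lim] have "\<forall>\<^sub>F t in F. dist (t, \<phi> t) (a, c) < e"
        using that by (rule tendstoD)
      with S[OF that] single
      have "\<forall>\<^sub>F t in F. t \<in> S e \<inter> I \<and> ({t} \<times> f t) \<inter> (ball (a, c) e \<inter> I \<times> I) \<noteq> {}"
        by eventually_elim (auto simp: graph_point_near_iff dist_commute)
      then show ?thesis using eventually_happens[of _ F] \<open>F \<noteq> bot\<close> by blast
    qed
    then show ?thesis using c by auto
  qed
  show "?L \<subseteq> {c}"
  proof (rule subsetI, rule ccontr)
    fix s assume s: "s \<in> ?L" "s \<notin> {c}"
    \<comment> \<open>Near \<open>a\<close> the values are within \<open>r\<close> of \<open>c\<close>, and a graph point witnessing \<open>s\<close> has its value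
        within \<open>r\<close> of \<open>s\<close>; half the distance makes the two incompatible.\<close>
    define r where "r = dist s c / 2"
    have "r > 0" using s by (simp add: r_def)
    then obtain \<delta> where \<delta>: "\<delta> > 0" "\<forall>t\<in>S \<delta>. f t = {\<phi> t} \<and> dist (\<phi> t) c < r"
      using near[OF eventually_conj[OF single tendstoD[OF lim]]] by meson
    define e where "e = min \<delta> r"
    have "e > 0" using \<delta> \<open>r > 0\<close> by (simp add: e_def)
    then obtain z where z: "z \<in> S e" "({z} \<times> f z) \<inter> (ball (a, s) e \<inter> I \<times> I) \<noteq> {}"
      using s(1) by blast
    have "z \<in> S \<delta>" using z(1) Smono[of e \<delta>] by (auto simp: e_def)
    then have "f z = {\<phi> z}" "dist (\<phi> z) c < r" using \<delta> by auto
    then have "dist (a, s) (z, \<phi> z) < e" using z(2) by (simp add: graph_point_near_iff)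
    then have "dist s (\<phi> z) < r"
      using dist_snd_le[of "(a, s)" "(z, \<phi> z)"] by (simp add: e_def)
    then show False using \<open>dist (\<phi> z) c < r\<close> dist_triangle[of s c "\<phi> z"]
      by (simp add: r_def)
  qed
qed

lemma Lim_down_singleton:
  assumes "(\<phi> \<longlongrightarrow> c) (at_right a)" "c \<in> I" "a < b"
    and "\<And>t. t \<in> {a<..<b} \<Longrightarrow> t \<in> I \<and> \<phi> t \<in> I \<and> f t = {\<phi> t}"
  shows "Lim_down I f a = {c}"
  unfolding Lim_down_def
proof (rule one_sided_limit_singleton[OF assms(1)])
  show "\<exists>e>0. \<forall>t\<in>{a<..<a + e}. P t" if P: "\<forall>\<^sub>F t in at_right a. P t" for P
  proof -
    obtain r where "r > a" "\<forall>t>a. t < r \<longrightarrow> P t" using P unfolding eventually_at_right_field by blast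
    then show ?thesis by (intro exI[of _ "r - a"]) auto
  qed
  show "\<forall>\<^sub>F t in at_right a. t \<in> I \<and> \<phi> t \<in> I \<and> f t = {\<phi> t}"
    using eventually_at_right_real[OF \<open>a < b\<close>] by eventually_elim (use assms in blast)
  show "\<forall>\<^sub>F t in at_right a. t \<in> {a<..<a + e}" if "e > 0" for e
    using that by (intro eventually_at_right_real) simp
  show "at_right a \<le> nhds a" by (simp add: at_within_def)
qed (use assms in auto)

lemma Lim_up_singleton:
  assumes "(\<phi> \<longlongrightarrow> d) (at_left b)" "d \<in> I" "a < b"
    and "\<And>t. t \<in> {a<..<b} \<Longrightarrow> t \<in> I \<and> \<phi> t \<in> I \<and> f t = {\<phi> t}"
  shows "Lim_up I f b = {d}"
  unfolding Lim_up_def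
proof (rule one_sided_limit_singleton[OF assms(1)])
  show "\<exists>e>0. \<forall>t\<in>{b - e<..<b}. P t" if P: "\<forall>\<^sub>F t in at_left b. P t" for P
  proof -
    obtain r where "r < b" "\<forall>t>r. t < b \<longrightarrow> P t" using P unfolding eventually_at_left_field by blast
    then show ?thesis by (intro exI[of _ "b - r"]) auto
  qed
  show "\<forall>\<^sub>F t in at_left b. t \<in> I \<and> \<phi> t \<in> I \<and> f t = {\<phi> t}"
    using eventually_at_left_real[OF \<open>a < b\<close>] by eventually_elim (use assms in blast)
  show "\<forall>\<^sub>F t in at_left b. t \<in> {b - e<..<b}" if "e > 0" for e
    using that by (intro eventually_at_left_real) simp
  show "at_left b \<le> nhds b" by (simp add: at_within_def)
qed (use assms in auto)

lemma countably_Markov_closed: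
  assumes "countably_Markov x y A f"
  shows "closed A"
  using assms by (auto simp: countably_Markov_def derived_set_def closed_limpt)

lemma countably_Markov_partition:
  assumes "countably_Markov x y A f"
  shows "closed A" "A \<subseteq> {x..y}" "x \<in> A" "y \<in> A"
  using countably_Markov_closed[OF assms] assms by (simp_all add: countably_Markov_def)

lemma countably_Markov_values:
  assumes "countably_Markov x y A f" "t \<in> {x..y}"
  shows "f t \<subseteq> {x..y}"
  using assms by (auto simp: countably_Markov_def set_valued_on_def dest!: closedin_imp_subset)

text \<open>
  At a point of \<open>A - A'\<close> the whole one-sided limit lies in \<open>A\<close>. At a point of \<open>A'\<close> only its
  minimum and maximum do, but the minimum of a singleton is its element.
\<close>

lemma Markov_Lim_singleton_in_A:
  assumes M: "countably_Markov x y A f" and "a \<in> A"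
  shows "a \<noteq> y \<Longrightarrow> Lim_down {x..y} f a = {c} \<Longrightarrow> c \<in> A"
    and "a \<noteq> x \<Longrightarrow> Lim_up {x..y} f a = {c} \<Longrightarrow> c \<in> A"
proof -
  have iso: "\<And>a. a \<in> A - derived_set A \<Longrightarrow> Lim_down {x..y} f a \<subseteq> A \<and> Lim_up {x..y} f a \<subseteq> A"
    and acc: "\<And>a. a \<in> derived_set A \<Longrightarrow> (a \<noteq> x \<longrightarrow> min_in (Lim_up {x..y} f a) A) \<and>
      (a \<noteq> y \<longrightarrow> min_in (Lim_down {x..y} f a) A)"
    using M by (simp_all add: countably_Markov_def)
  show "c \<in> A" if "a \<noteq> y" "Lim_down {x..y} f a = {c}"
    using that iso[of a] acc[of a] \<open>a \<in> A\<close> by (cases "a \<in> derived_set A") (auto simp: min_in_def)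
  show "c \<in> A" if "a \<noteq> x" "Lim_up {x..y} f a = {c}"
    using that iso[of a] acc[of a] \<open>a \<in> A\<close> by (cases "a \<in> derived_set A") (auto simp: min_in_def)
qed

text \<open>
  A gap lies in a component of \<open>I - A\<close>, so \<open>f\<close> is single-valued and injective on it, and upper
  semicontinuity of a single-valued function is continuity. The decreasing case is the increasing
  one for \<open>- \<phi>\<close>. The disjunction records the orientation.
\<close>

lemma Markov_on_gap:
  assumes M: "countably_Markov x y A f" and g: "gap A a b"
  obtains c d \<phi> where "c \<in> A" "d \<in> A" "Lim_down {x..y} f a = {c..c}" "Lim_up {x..y} f b = {d..d}"
    "\<forall>t\<in>{a<..<b}. f t = {\<phi> t}"
    "c < d \<and> strict_mono_on {a<..<b} \<phi> \<and> \<phi> ` {a<..<b} = {c<..<d} \<or>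
     d < c \<and> strict_antimono_on {a<..<b} \<phi> \<and> \<phi> ` {a<..<b} = {d<..<c}"
proof -
  note result = that
  have AI: "A \<subseteq> {x..y}" using M by (simp add: countably_Markov_def)
  have ab: "a \<in> A" "b \<in> A" "a < b" "A \<inter> {a<..<b} = {}" using g by (auto simp: gap_def)
  have abI: "a \<in> {x..y}" "b \<in> {x..y}" using ab AI by auto
  then have sub: "{a<..<b} \<subseteq> {x..y} - A" using ab by force
  obtain m where m: "m \<in> {a<..<b}" using ab(3) dense by force
  define C where "C = connected_component_set ({x..y} - A) m"
  have "C \<in> components ({x..y} - A)" using m sub by (auto simp: C_def components_def)
  then have C: "(\<forall>t\<in>C. is_singleton (f t)) \<and> inj_on f C"
    using M by (simp add: countably_Markov_def)
  have gapC: "{a<..<b} \<subseteq> C"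
    unfolding C_def using m sub by (intro connected_component_maximal) auto
  define \<phi> where "\<phi> t = the_elem (f t)" for t
  have f\<phi>: "f t = {\<phi> t}" if "t \<in> {a<..<b}" for t
    using that gapC C unfolding \<phi>_def is_singleton_the_elem by blast
  have \<phi>I: "\<phi> t \<in> {x..y}" if "t \<in> {a<..<b}" for t
    using that f\<phi>[OF that] countably_Markov_values[OF M, of t] sub by auto
  have inj: "inj_on \<phi> {a<..<b}"
    using C gapC f\<phi> by (metis inj_on_def subsetD)
  have cont: "continuous_on {a<..<b} \<phi>"
    unfolding continuous_on_open_invariant
  proof (intro allI impI)
    fix V :: "real set" assume "open V"
    then have "openin (top_of_set {x..y}) ({x..y} \<inter> V)" by (rule openin_open_Int)
    then have "openin (top_of_set {x..y}) {t \<in> {x..y}. f t \<subseteq> {x..y} \<inter> V}"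
      using M by (simp only: countably_Markov_def usc_on_def)
    then obtain W where W: "open W" "{t \<in> {x..y}. f t \<subseteq> {x..y} \<inter> V} = {x..y} \<inter> W"
      by (auto simp: openin_open)
    have "W \<inter> {a<..<b} = \<phi> -` V \<inter> {a<..<b}"
    proof (intro set_eqI)
      fix t show "t \<in> W \<inter> {a<..<b} \<longleftrightarrow> t \<in> \<phi> -` V \<inter> {a<..<b}"
      proof (cases "t \<in> {a<..<b}")
        case True
        then have "t \<in> {x..y}" using sub by blast
        then have "t \<in> W \<longleftrightarrow> f t \<subseteq> {x..y} \<inter> V" using W(2) by blast
        then show ?thesis using True f\<phi>[OF True] \<phi>I[OF True] by auto
      qed auto
    qed
    then show "\<exists>W. open W \<and> W \<inter> {a<..<b} = \<phi> -` V \<inter> {a<..<b}" using W(1) by blast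
  qed
  have main: thesis
    if cI: "c \<in> {x..y}" and dI: "d \<in> {x..y}"
      and lims: "(\<phi> \<longlongrightarrow> c) (at_right a)" "(\<phi> \<longlongrightarrow> d) (at_left b)"
      and orient: "c < d \<and> strict_mono_on {a<..<b} \<phi> \<and> \<phi> ` {a<..<b} = {c<..<d} \<or>
        d < c \<and> strict_antimono_on {a<..<b} \<phi> \<and> \<phi> ` {a<..<b} = {d<..<c}" for c d
  proof -
    have loc: "t \<in> {x..y} \<and> \<phi> t \<in> {x..y} \<and> f t = {\<phi> t}" if "t \<in> {a<..<b}" for t
      using that f\<phi> \<phi>I sub by blast
    have L: "Lim_down {x..y} f a = {c}" "Lim_up {x..y} f b = {d}"
      using Lim_down_singleton[OF lims(1) cI ab(3) loc] Lim_up_singleton[OF lims(2) dI ab(3) loc]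
      by blast+
    have "a \<noteq> y" "b \<noteq> x" using ab abI by auto
    then have "c \<in> A" "d \<in> A"
      using Markov_Lim_singleton_in_A(1)[OF M ab(1) _ L(1)] Markov_Lim_singleton_in_A(2)[OF M ab(2) _ L(2)]
      by blast+
    then show thesis using L f\<phi> orient by (intro result[of c d \<phi>]) simp_all
  qed
  have "strict_mono_on {a<..<b} \<phi> \<or> strict_antimono_on {a<..<b} \<phi>"
    using injective_eq_monotone_map[OF _ cont] inj by (simp add: is_interval_oo)
  then show thesis
  proof
    assume mono: "strict_mono_on {a<..<b} \<phi>"
    have "\<phi> ` {a<..<b} \<subseteq> {x..y}" using \<phi>I by blast
    from increasing_image_Ioo[OF ab(3) cont mono this] show thesis using mono main by metis
  next
    assume anti: "strict_antimono_on {a<..<b} \<phi>"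
    have cont': "continuous_on {a<..<b} (\<lambda>t. - \<phi> t)" using cont by (rule continuous_on_minus)
    have mono': "strict_mono_on {a<..<b} (\<lambda>t. - \<phi> t)" using anti by (auto simp: monotone_on_def)
    have bd': "(\<lambda>t. - \<phi> t) ` {a<..<b} \<subseteq> {-y..-x}" using \<phi>I by force
    obtain c d where cd: "c < d" "c \<in> {-y..-x}" "d \<in> {-y..-x}"
      "(\<lambda>t. - \<phi> t) ` {a<..<b} = {c<..<d}"
      "((\<lambda>t. - \<phi> t) \<longlongrightarrow> c) (at_right a)" "((\<lambda>t. - \<phi> t) \<longlongrightarrow> d) (at_left b)"
      using increasing_image_Ioo[OF ab(3) cont' mono' bd'] by blast
    have "\<phi> ` {a<..<b} = uminus ` (\<lambda>t. - \<phi> t) ` {a<..<b}" by (simp add: image_image)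
    then have "\<phi> ` {a<..<b} = {-d<..<-c}" using cd(4) by simp
    moreover have "(\<phi> \<longlongrightarrow> - c) (at_right a)" "(\<phi> \<longlongrightarrow> - d) (at_left b)"
      using tendsto_minus[OF cd(5)] tendsto_minus[OF cd(6)] by simp_all
    ultimately show thesis using main[of "- c" "- d"] cd(1-3) anti by auto
  qed
qed

section \<open>Lifting an extension of the pattern bijection\<close>

lemma same_patternD:
  assumes S: "same_pattern_via \<tau> I A f J B g"
  shows "bij_betw \<tau> A B" "strict_mono_on A \<tau>"
    and "\<lbrakk>a \<in> A; u \<in> A; v \<in> A; u \<le> v\<rbrakk> \<Longrightarrow> f a = {u..v} \<longleftrightarrow> g (\<tau> a) = {\<tau> u..\<tau> v}"
    and "\<lbrakk>a \<in> A; u \<in> A; v \<in> A; u \<le> v\<rbrakk> \<Longrightarrow>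
      Lim_up I f a = {u..v} \<longleftrightarrow> Lim_up J g (\<tau> a) = {\<tau> u..\<tau> v}"
    and "\<lbrakk>a \<in> A; u \<in> A; v \<in> A; u \<le> v\<rbrakk> \<Longrightarrow>
      Lim_down I f a = {u..v} \<longleftrightarrow> Lim_down J g (\<tau> a) = {\<tau> u..\<tau> v}"
  using S by (simp_all only: same_pattern_via_def)

definition extends :: "real set \<Rightarrow> real set \<Rightarrow> (real \<Rightarrow> real) \<Rightarrow> real set \<Rightarrow> (real \<Rightarrow> real) \<Rightarrow> bool" where
  "extends I J \<tau> A h \<longleftrightarrow> strict_mono_on I h \<and> h ` I = J \<and> (\<forall>a\<in>A. h a = \<tau> a)"

text \<open>
  The lift is \<open>k = \<psi>\<^sup>-\<^sup>1 \<circ> h \<circ> \<phi>\<close>, where \<open>\<phi>\<close> and \<open>\<psi>\<close> are \<open>f\<close> and \<open>g\<close> on the gap and on its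
  counterpart. The pattern makes the endpoints \<open>c', d'\<close> of the image of \<open>\<psi>\<close> equal to \<open>h c, h d\<close>.
  Hence the image of \<open>\<psi>\<close> is the \<open>h\<close>-image of that of \<open>\<phi>\<close>, so that \<open>k\<close> is defined and onto; and
  \<open>\<phi>\<close> and \<open>\<psi>\<close> both increase or both decrease, so that \<open>k\<close> increases.
\<close>

lemma lift_on_gap:
  assumes F: "countably_Markov x y A f" and G: "countably_Markov x' y' B g"
    and S: "same_pattern_via \<tau> {x..y} A f {x'..y'} B g"
    and h: "extends {x..y} {x'..y'} \<tau> A h" and g: "gap A a b"
  shows "\<exists>k. strict_mono_on {a<..<b} k \<and> k ` {a<..<b} = {\<tau> a<..<\<tau> b} \<and>
    (\<forall>t\<in>{a<..<b}. g (k t) = h ` f t)"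
proof -
  let ?U = "{a<..<b}" and ?V = "{\<tau> a<..<\<tau> b}"
  note \<tau> = same_patternD(1,2)[OF S]
  have AI: "A \<subseteq> {x..y}" using F by (simp add: countably_Markov_def)
  have ab: "a \<in> A" "b \<in> A" using g by (auto simp: gap_def)
  then have g': "gap B (\<tau> a) (\<tau> b)" using gap_transfer[OF \<tau>] g by blast
  from Markov_on_gap[OF F g] obtain c d \<phi> where \<phi>: "c \<in> A" "d \<in> A"
    "Lim_down {x..y} f a = {c..c}" "Lim_up {x..y} f b = {d..d}"
    "\<forall>t\<in>?U. f t = {\<phi> t}"
    "c < d \<and> strict_mono_on ?U \<phi> \<and> \<phi> ` ?U = {c<..<d} \<or>
     d < c \<and> strict_antimono_on ?U \<phi> \<and> \<phi> ` ?U = {d<..<c}" .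
  from Markov_on_gap[OF G g'] obtain c' d' \<psi> where "c' \<in> B" "d' \<in> B" and \<psi>:
    "Lim_down {x'..y'} g (\<tau> a) = {c'..c'}" "Lim_up {x'..y'} g (\<tau> b) = {d'..d'}"
    "\<forall>t\<in>?V. g t = {\<psi> t}"
    "c' < d' \<and> strict_mono_on ?V \<psi> \<and> \<psi> ` ?V = {c'<..<d'} \<or>
     d' < c' \<and> strict_antimono_on ?V \<psi> \<and> \<psi> ` ?V = {d'<..<c'}" .
  have hm: "strict_mono_on {x..y} h" "h ` {x..y} = {x'..y'}" and h\<tau>: "\<And>e. e \<in> A \<Longrightarrow> h e = \<tau> e"
    using h by (auto simp: extends_def)
  have "Lim_down {x'..y'} g (\<tau> a) = {\<tau> c..\<tau> c}" "Lim_up {x'..y'} g (\<tau> b) = {\<tau> d..\<tau> d}"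
    using same_patternD(5)[OF S ab(1) \<phi>(1) \<phi>(1) order_refl] \<phi>(3)
      same_patternD(4)[OF S ab(2) \<phi>(2) \<phi>(2) order_refl] \<phi>(4) by blast+
  then have c'd': "c' = h c" "d' = h d" using \<psi>(1,2) h\<tau>[OF \<phi>(1)] h\<tau>[OF \<phi>(2)] by auto
  have cdI: "c \<in> {x..y}" "d \<in> {x..y}" using \<phi>(1,2) AI by auto
  have hless: "h u < h v \<longleftrightarrow> u < v" if "u \<in> {x..y}" "v \<in> {x..y}" for u v
    using that hm(1) by (simp add: strict_mono_on_less)
  define W where "W = \<phi> ` ?U"
  consider (inc) "W = {c<..<d}" "strict_mono_on ?U \<phi>" "strict_mono_on ?V \<psi>" "\<psi> ` ?V = {h c<..<h d}"
    | (dec) "W = {d<..<c}" "strict_antimono_on ?U \<phi>" "strict_antimono_on ?V \<psi>" "\<psi> ` ?V = {h d<..<h c}"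
    using \<phi>(6)
  proof (elim disjE conjE)
    assume "c < d" and f: "strict_mono_on ?U \<phi>" "\<phi> ` ?U = {c<..<d}"
    then have "\<not> h d < h c" using hless[OF cdI(2,1)] by simp
    then have "strict_mono_on ?V \<psi> \<and> \<psi> ` ?V = {h c<..<h d}" using \<psi>(4) unfolding c'd' by blast
    then show thesis using f by (intro inc) (simp_all add: W_def)
  next
    assume "d < c" and f: "strict_antimono_on ?U \<phi>" "\<phi> ` ?U = {d<..<c}"
    then have "\<not> h c < h d" using hless[OF cdI] by simp
    then have "strict_antimono_on ?V \<psi> \<and> \<psi> ` ?V = {h d<..<h c}" using \<psi>(4) unfolding c'd' by blast
    then show thesis using f by (intro dec) (simp_all add: W_def)
  qed
  then have "W \<subseteq> {x..y} \<and> \<psi> ` ?V = h ` W \<and>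
      (strict_mono_on ?U \<phi> \<and> strict_mono_on ?V \<psi> \<or>
       strict_antimono_on ?U \<phi> \<and> strict_antimono_on ?V \<psi>)"
  proof cases
    case inc
    then have "W \<subseteq> {x..y}" "\<psi> ` ?V = h ` W"
      using increasing_bijection_image_Ioo[OF hm cdI] cdI by auto
    then show ?thesis using inc by blast
  next
    case dec
    then have "W \<subseteq> {x..y}" "\<psi> ` ?V = h ` W"
      using increasing_bijection_image_Ioo[OF hm cdI(2,1)] cdI by auto
    then show ?thesis using dec by blast
  qed
  then have W: "W \<subseteq> {x..y}" and \<psi>V: "\<psi> ` ?V = h ` W"
    and same: "strict_mono_on ?U \<phi> \<and> strict_mono_on ?V \<psi> \<or>
      strict_antimono_on ?U \<phi> \<and> strict_antimono_on ?V \<psi>"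
    by blast+
  define k where "k t = inv_into ?V \<psi> (h (\<phi> t))" for t
  have kV: "k t \<in> ?V" and \<psi>k: "\<psi> (k t) = h (\<phi> t)" if "t \<in> ?U" for t
  proof -
    have "h (\<phi> t) \<in> \<psi> ` ?V" using that \<psi>V unfolding W_def by blast
    then show "k t \<in> ?V" "\<psi> (k t) = h (\<phi> t)"
      unfolding k_def by (rule inv_into_into, rule f_inv_into_f)
  qed
  have kmono: "strict_mono_on ?U k"
  proof (rule strict_mono_onI)
    fix s t assume st: "s \<in> ?U" "t \<in> ?U" "s < t"
    have \<phi>I: "\<phi> s \<in> {x..y}" "\<phi> t \<in> {x..y}" using st W unfolding W_def by blast+
    show "k s < k t"
      using same
    proof
      assume m: "strict_mono_on ?U \<phi> \<and> strict_mono_on ?V \<psi>"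
      then have "\<psi> (k s) < \<psi> (k t)" using st \<phi>I strict_mono_onD[of ?U \<phi> s t] by (simp add: \<psi>k hless)
      then show ?thesis using m strict_mono_on_less[OF _ kV[OF st(1)] kV[OF st(2)], of \<psi>] by simp
    next
      assume m: "strict_antimono_on ?U \<phi> \<and> strict_antimono_on ?V \<psi>"
      then have "\<psi> (k t) < \<psi> (k s)" using st \<phi>I monotone_onD[of ?U "(<)" "(>)" \<phi> s t] by (simp add: \<psi>k hless)
      moreover have "strict_mono_on ?V (\<lambda>s. - \<psi> s)"
        using m unfolding monotone_on_def by simp
      ultimately show ?thesis using strict_mono_on_less[OF _ kV[OF st(1)] kV[OF st(2)], of "\<lambda>s. - \<psi> s"]
        by simp
    qed
  qed
  have inj\<psi>: "inj_on \<psi> ?V"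
  proof (rule linorder_inj_onI')
    fix s t assume st: "s \<in> ?V" "t \<in> ?V" "s < t"
    then have "\<psi> s < \<psi> t \<or> \<psi> t < \<psi> s" using same by (meson monotone_onD)
    then show "\<psi> s \<noteq> \<psi> t" by auto
  qed
  have "?V \<subseteq> k ` ?U"
  proof
    fix s assume s: "s \<in> ?V"
    then have "\<psi> s \<in> h ` W" using \<psi>V by blast
    then obtain t where t: "t \<in> ?U" "\<psi> s = h (\<phi> t)" by (auto simp: W_def)
    then have "k t = s" using s inj\<psi> by (simp add: k_def flip: t(2))
    then show "s \<in> k ` ?U" using t(1) by blast
  qed
  then have "k ` ?U = ?V" using kV by blast
  moreover have "g (k t) = h ` f t" if "t \<in> ?U" for t
    using bspec[OF \<phi>(5) that] bspec[OF \<psi>(3) kV[OF that]] \<psi>k[OF that] by simp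
  ultimately show ?thesis using kmono by blast
qed

lemma lift_extension:
  assumes F: "countably_Markov x y A f" and G: "countably_Markov x' y' B g"
    and S: "same_pattern_via \<tau> {x..y} A f {x'..y'} B g"
    and h: "extends {x..y} {x'..y'} \<tau> A h"
  shows "\<exists>h'. extends {x..y} {x'..y'} \<tau> A h' \<and> (\<forall>t\<in>{x..y}. g (h' t) = h ` f t)"
proof -
  note A = countably_Markov_partition[OF F] and B = countably_Markov_partition[OF G]
  note \<tau> = same_patternD(1,2)[OF S]
  have on_A: "g (\<tau> a) = h ` f a" if a: "a \<in> A" for a
  proof -
    have "\<forall>a\<in>A. \<exists>u\<in>A. \<exists>v\<in>A. u \<le> v \<and> f a = {u..v}" using F by (simp add: countably_Markov_def)
    then obtain u v where uv: "u \<in> A" "v \<in> A" "u \<le> v" "f a = {u..v}" using a by blast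
    then have "g (\<tau> a) = {\<tau> u..\<tau> v}" using same_patternD(3)[OF S a uv(1-3)] by blast
    moreover have "h ` {u..v} = {h u..h v}"
      using h uv A(2) by (intro increasing_bijection_image_Icc[of "{x..y}"]) (auto simp: extends_def)
    ultimately show ?thesis using h uv by (simp add: extends_def)
  qed
  show ?thesis
  proof (rule glue_over_gaps[OF A B \<tau>, where P = "\<lambda>t s. g s = h ` f t"])
    show "\<exists>k. strict_mono_on {a<..<b} k \<and> k ` {a<..<b} = {\<tau> a<..<\<tau> b} \<and>
        (\<forall>t\<in>{a<..<b}. g (k t) = h ` f t)" if "gap A a b" for a b
      using F G S h that by (rule lift_on_gap)
  next
    fix h' assume h': "strict_mono_on {x..y} h'" "h' ` {x..y} = {x'..y'}"
      "\<And>a. a \<in> A \<Longrightarrow> h' a = \<tau> a" "\<And>t. t \<in> {x..y} - A \<Longrightarrow> g (h' t) = h ` f t"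
    have "g (h' t) = h ` f t" if "t \<in> {x..y}" for t
      using h'(4)[of t] h'(3)[of t] on_A[of t] that by (cases "t \<in> A") simp_all
    then show "\<exists>h'. extends {x..y} {x'..y'} \<tau> A h' \<and> (\<forall>t\<in>{x..y}. g (h' t) = h ` f t)"
      using h'(1-3) unfolding extends_def by blast
  qed
qed

text \<open>The extension is affine on each gap.\<close>

lemma extension_exists:
  assumes A: "closed A" "A \<subseteq> {x..y}" "x \<in> A" "y \<in> A"
    and B: "closed B" "B \<subseteq> {x'..y'}" "x' \<in> B" "y' \<in> B"
    and \<tau>: "bij_betw \<tau> A B" "strict_mono_on A \<tau>"
  shows "\<exists>h. extends {x..y} {x'..y'} \<tau> A h"
proof -
  have "\<exists>k. strict_mono_on {a<..<b} k \<and> k ` {a<..<b} = {\<tau> a<..<\<tau> b} \<and> (\<forall>t\<in>{a<..<b}. True)"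
    if g: "gap A a b" for a b
  proof -
    have lt: "a < b" "\<tau> a < \<tau> b" using g \<tau>(2) by (auto simp: gap_def strict_mono_onD)
    define m where "m = (\<tau> b - \<tau> a) / (b - a)"
    define k where "k t = m * t + (\<tau> a - m * a)" for t
    have m: "m > 0" using lt by (simp add: m_def)
    have "m * (b - a) = \<tau> b - \<tau> a" using lt by (simp add: m_def)
    then have mba: "m * b - m * a = \<tau> b - \<tau> a" by (simp add: right_diff_distrib)
    have km: "strict_mono k" using m by (simp add: k_def strict_mono_def)
    have "k ` {a..b} = {\<tau> a..\<tau> b}"
      using m mba lt unfolding k_def by (subst image_affinity_atLeastAtMost) auto
    moreover have "k a = \<tau> a" "k b = \<tau> b" using mba by (simp_all add: k_def)
    ultimately have "k ` {a<..<b} = {\<tau> a<..<\<tau> b}"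
      using increasing_bijection_image_Ioo[of "{a..b}" k "\<tau> a" "\<tau> b" a b] km lt
      by (simp add: strict_mono_on_def strict_mono_def)
    moreover have "strict_mono_on {a<..<b} k" using km by (simp add: strict_mono_on_def strict_mono_def)
    ultimately show ?thesis by blast
  qed
  from glue_over_gaps[OF A B \<tau>, where P = "\<lambda>_ _. True", OF this]
  show ?thesis unfolding extends_def by metis
qed

section \<open>Homeomorphic inverse limits\<close>

text \<open>
  The equation \<open>sq\<close> says that \<open>h\<^sub>n\<close> maps the set of possible \<open>n\<close>-th coordinates over \<open>t\<close>
  onto, and not just into, the set of those over \<open>h\<^sub>n\<^sub>+\<^sub>1 t\<close>. Equality is what makes the
  coordinatewise inverse also map threads to threads.
\<close>

lemma inverse_limits_homeomorphic:
  fixes h :: "nat \<Rightarrow> real \<Rightarrow> real"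
  assumes mono: "\<And>n. strict_mono_on {x..y} (h n)" and img: "\<And>n. h n ` {x..y} = {x'..y'}"
    and f: "\<And>n t. t \<in> {x..y} \<Longrightarrow> f n t \<subseteq> {x..y}"
    and sq: "\<And>n t. t \<in> {x..y} \<Longrightarrow> g n (h (Suc n) t) = h n ` f n t"
  shows "inverse_limit {x..y} f homeomorphic inverse_limit {x'..y'} g"
proof -
  let ?I = "{x..y}" and ?J = "{x'..y'}"
  define k where "k n = inv_into ?I (h n)" for n
  have kmono: "strict_mono_on ?J (k n)" for n
    using inv_into_increasing[OF mono, of n] by (simp add: img k_def)
  have inj: "inj_on (h n) ?I" for n using mono by (rule strict_mono_on_imp_inj_on)
  have kh: "k n (h n t) = t" if "t \<in> ?I" for n t using that inj by (simp add: k_def)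
  have hk: "h n (k n s) = s" if "s \<in> ?J" for n s using that img by (simp add: k_def f_inv_into_f)
  have hJ: "h n t \<in> ?J" if "t \<in> ?I" for n t using that img by blast
  have kI: "k n s \<in> ?I" if "s \<in> ?J" for n s
    unfolding k_def by (rule inv_into_into) (use that img in blast)
  have kimg: "k n ` ?J = ?I" for n
  proof
    show "k n ` ?J \<subseteq> ?I" using kI by blast
    show "?I \<subseteq> k n ` ?J"
    proof
      fix t assume "t \<in> ?I"
      then show "t \<in> k n ` ?J" using kh[of t n] hJ[of t n] by (metis imageI)
    qed
  qed
  have coord: "continuous_on (inverse_limit X F) (\<lambda>p n. u n (p n))"
    if "\<And>n. continuous_on X (u n)" for X F and u :: "nat \<Rightarrow> real \<Rightarrow> real"
  proof (rule continuous_on_coordinatewise_then_product)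
    fix n
    have "continuous_on (inverse_limit X F) (\<lambda>p. p n)"
      by (rule continuous_on_subset[OF continuous_on_product_coordinates]) simp
    with that show "continuous_on (inverse_limit X F) (\<lambda>p. u n (p n))"
      by (rule continuous_on_compose2) (auto simp: inverse_limit_def)
  qed
  have fwd: "(\<lambda>n. h n (p n)) \<in> inverse_limit ?J g" if "p \<in> inverse_limit ?I f" for p
  proof -
    have p: "p n \<in> ?I" "p n \<in> f n (p (Suc n))" for n using that by (auto simp: inverse_limit_def)
    have "h n (p n) \<in> g n (h (Suc n) (p (Suc n)))" for n
      unfolding sq[OF p(1)] using p(2) by (rule imageI)
    then show ?thesis using hJ p unfolding inverse_limit_def by blast
  qed
  have bwd: "(\<lambda>n. k n (q n)) \<in> inverse_limit ?I f" if "q \<in> inverse_limit ?J g" for q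
  proof -
    have q: "q n \<in> ?J" "q n \<in> g n (q (Suc n))" for n using that by (auto simp: inverse_limit_def)
    have "k n (q n) \<in> f n (k (Suc n) (q (Suc n)))" for n
    proof -
      have t: "k (Suc n) (q (Suc n)) \<in> ?I" using kI q by blast
      have "q n \<in> h n ` f n (k (Suc n) (q (Suc n)))"
        using q(2)[of n] sq[OF t, of n] hk[OF q(1), of "Suc n" "Suc n"] by simp
      then obtain z where z: "z \<in> f n (k (Suc n) (q (Suc n)))" "q n = h n z" by blast
      then have "k n (q n) = z" using f[OF t, of n] kh[of z n] by auto
      then show ?thesis using z(1) by simp
    qed
    then show ?thesis using kI q unfolding inverse_limit_def by blast
  qed
  show ?thesis
  proof (rule homeomorphicI)
    show "continuous_on (inverse_limit ?I f) (\<lambda>p n. h n (p n))"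
      using coord increasing_surjection_continuous[OF mono img] by blast
    show "continuous_on (inverse_limit ?J g) (\<lambda>q n. k n (q n))"
      using coord increasing_surjection_continuous[OF kmono kimg] by blast
    show kh': "(\<lambda>n. k n (h n (p n))) = p" if "p \<in> inverse_limit ?I f" for p
      using that kh by (intro ext) (simp add: inverse_limit_def)
    show hk': "(\<lambda>n. h n (k n (q n))) = q" if "q \<in> inverse_limit ?J g" for q
      using that hk by (intro ext) (simp add: inverse_limit_def)
    show "(\<lambda>p n. h n (p n)) ` inverse_limit ?I f = inverse_limit ?J g"
    proof
      show "(\<lambda>p n. h n (p n)) ` inverse_limit ?I f \<subseteq> inverse_limit ?J g" using fwd by blast
      show "inverse_limit ?J g \<subseteq> (\<lambda>p n. h n (p n)) ` inverse_limit ?I f"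
      proof
        fix q assume "q \<in> inverse_limit ?J g"
        from hk'[OF this, symmetric] bwd[OF this]
        show "q \<in> (\<lambda>p n. h n (p n)) ` inverse_limit ?I f" by (rule image_eqI)
      qed
    qed
    show "(\<lambda>q n. k n (q n)) ` inverse_limit ?J g = inverse_limit ?I f"
    proof
      show "(\<lambda>q n. k n (q n)) ` inverse_limit ?J g \<subseteq> inverse_limit ?I f" using bwd by blast
      show "inverse_limit ?I f \<subseteq> (\<lambda>q n. k n (q n)) ` inverse_limit ?J g"
      proof
        fix p assume "p \<in> inverse_limit ?I f"
        from kh'[OF this, symmetric] fwd[OF this]
        show "p \<in> (\<lambda>q n. k n (q n)) ` inverse_limit ?J g" by (rule image_eqI)
      qed
    qed
  qed
qed

theorem theorem4p1:
  fixes x y x' y' :: real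
    and A B :: "real set"
    and f g :: "nat \<Rightarrow> real \<Rightarrow> real set"
  assumes "x < y" and "x' < y'"
    and "\<And>n. countably_Markov x y A (f n)"
    and "\<And>n. countably_Markov x' y' B (g n)"
    and "\<exists>\<tau>. \<forall>n. same_pattern_via \<tau> {x..y} A (f n) {x'..y'} B (g n)"
  shows "inverse_limit {x..y} f homeomorphic inverse_limit {x'..y'} g"
proof -
  note F = assms(3) and G = assms(4)
  obtain \<tau> where S: "\<And>n. same_pattern_via \<tau> {x..y} A (f n) {x'..y'} B (g n)"
    using assms(5) by blast
  let ?ext = "extends {x..y} {x'..y'} \<tau> A"
  have "\<exists>h. ?ext h"
    using countably_Markov_partition[OF F] countably_Markov_partition[OF G] same_patternD(1,2)[OF S]
    by (rule extension_exists)
  then have "\<exists>h. \<forall>n. ?ext (h n) \<and> (\<forall>t\<in>{x..y}. g n (h (Suc n) t) = h n ` f n t)"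
    using lift_extension[OF F G S]
    by (intro dependent_nat_choice[where P = "\<lambda>_. ?ext"
          and Q = "\<lambda>n h h'. \<forall>t\<in>{x..y}. g n (h' t) = h ` f n t"])
  then obtain h where h: "\<And>n. ?ext (h n)"
    and sq: "\<And>n t. t \<in> {x..y} \<Longrightarrow> g n (h (Suc n) t) = h n ` f n t"
    by blast
  show ?thesis
  proof (rule inverse_limits_homeomorphic[where h = h])
    show "strict_mono_on {x..y} (h n)" "h n ` {x..y} = {x'..y'}" for n
      using h by (simp_all add: extends_def)
  qed (fact countably_Markov_values[OF F] sq)+
qed

end
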